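(* Let $X$ be a nonempty topological space and let $\mathcal{E}$ be a connected coarse structure on $X$. Let $\mathfrak{C}=\mathfrak{C}_{\mathcal{E}}$ be the large scale resemblance induced by $\mathcal{E}$. Then $\mathfrak{N}_{\mathfrak{C}}$ is a nearness structure on $X$, and the topology induced by $\mathfrak{N}_{\mathfrak{C}}$ on $X$ is the same as the given topology of $X$.
   Context: $\mathcal{P}(X)$ is the power set of $X$. For $E,F\subseteq X\times X$: $E^{-1}=\{(y,x)\mid (x,y)\in E\}$, $E\circ F=\{(x,y)\mid \exists z,\ (x,z)\in F,\ (z,y)\in E\}$, and for $A\subseteq X$, $E(A)=\{b\in X\mid (a,b)\in E\text{ for some }a\in A\}$. A coarse structure on $X$ is a family $\mathcal{E}$ of subsets of $X\times X$ that contains the diagonal and is closed under subsets, finite unions, inverses $E^{-1}$ and compositions $E\circ F$. It is connected if for all $x,y\in X$ there is $E\in\mathcal{E}$ with $(x,y)\in E$. No compatibility between $\mathcal{E}$ and the topology is assumed. $\mathfrak{C}_{\mathcal{E}}\subseteq\mathcal{P}(\mathcal{P}(X))$: $\mathcal{A}\in\mathfrak{C}_{\mathcal{E}}$ iff there is $E\in\mathcal{E}$ such that $A\subseteq E(B)$ for all $A,B\in\mathcal{A}$. For $\mathfrak{C}\subseteq \mathcal{P}(\mathcal{P}(X))$, a set $B\subseteq X$ is bounded if $B=\emptyset$ or $\{B,\{x\}\}\in\mathfrak{C}$ for some $x\in X$. For $\mathcal{A},\mathcal{B}\subseteq\mathcal{P}(X)$: $\mathcal{B}\ll\mathcal{A}$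 means that for each $A\in\mathcal{A}$ there is $B\in\mathcal{B}$ with $B\subseteq A$; and $\mathcal{A}\vee\mathcal{B}=\{A\cup B\mid A\in\mathcal{A},B\in\mathcal{B}\}$. The intersection of the empty family of subsets of $X$ is $X$. $\mathfrak{N}_{\mathfrak{C}}$: $\mathcal{A}\in\mathfrak{N}_{\mathfrak{C}}$ iff either $\bigcap_{A\in\mathcal{A}}\overline{A}\neq\emptyset$ (closures in $X$), or there is $\mathcal{B}\in\mathfrak{C}$ such that $\mathcal{B}$ contains no bounded subset of $X$ and $\mathcal{B}\ll\mathcal{A}$. A nearness structure on $X$ is $\mathfrak{N}\subseteq\mathcal{P}(\mathcal{P}(X))$ such that: (i) if $\bigcap_{A\in\mathcal{A}}A\neq\emptyset$ then $\mathcal{A}\in\mathfrak{N}$; (ii) if $\mathcal{A}\in\mathfrak{N}$ and $\mathcal{A}\ll\mathcal{B}$ then $\mathcal{B}\in\mathfrak{N}$; (iii) no member of $\mathfrak{N}$ contains $\emptyset$ as an element; (iv) if $\mathcal{A},\mathcal{B}\notin\mathfrak{N}$ then $\mathcal{A}\vee\mathcal{B}\notin\mathfrak{N}$. The topology induced by a nearness $\mathfrak{N}$: a set $A\subseteq X$ is closed iff $A=\{x\in X\mid \{\{x\},A\}\in\mathfrak{N}\}$.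
   Formalization: The equality of the induced and given topologies is proved only when X is symmetric (R0: x in cl{y} implies y in cl{x}); without this it fails, e.g. for the Sierpinski space. That N_C is a nearness structure is proved for every nonempty X. *)

theory Defs
  imports "HOL-Analysis.Analysis"
begin

text \<open>All structures live on an explicit carrier set \<open>S\<close> (the \<open>topspace\<close> of the given topology).
  Note that the composition \<open>E \<circ> F\<close> of the coarse geometry literature (first \<open>F\<close>, then \<open>E\<close>)
  is \<open>F O E\<close> here, and that \<open>E(A)\<close> is \<open>E `` A\<close>.\<close>

definition coarse_structure :: "'a set \<Rightarrow> ('a \<times> 'a) set set \<Rightarrow> bool" where
  "coarse_structure S \<E> \<longleftrightarrow>
     \<E> \<subseteq> Pow (S \<times> S) \<and>
     Id_on S \<in> \<E> \<and>
     (\<forall>E\<in>\<E>. \<forall>F. F \<subseteq> E \<longrightarrow> F \<in> \<E>) \<and>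
     (\<forall>E\<in>\<E>. \<forall>F\<in>\<E>. E \<union> F \<in> \<E>) \<and>
     (\<forall>E\<in>\<E>. E\<inverse> \<in> \<E>) \<and>
     (\<forall>E\<in>\<E>. \<forall>F\<in>\<E>. F O E \<in> \<E>)"

definition coarse_connected :: "'a set \<Rightarrow> ('a \<times> 'a) set set \<Rightarrow> bool" where
  "coarse_connected S \<E> \<longleftrightarrow> (\<forall>x\<in>S. \<forall>y\<in>S. \<exists>E\<in>\<E>. (x, y) \<in> E)"

definition coarse_resemblance :: "'a set \<Rightarrow> ('a \<times> 'a) set set \<Rightarrow> 'a set set set" where
  "coarse_resemblance S \<E> =
     {\<A>. \<A> \<subseteq> Pow S \<and> (\<exists>E\<in>\<E>. \<forall>A\<in>\<A>. \<forall>B\<in>\<A>. A \<subseteq> E `` B)}"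

definition resemblance_bounded :: "'a set \<Rightarrow> 'a set set set \<Rightarrow> 'a set \<Rightarrow> bool" where
  "resemblance_bounded S \<CC> B \<longleftrightarrow> B \<subseteq> S \<and> (B = {} \<or> (\<exists>x\<in>S. {B, {x}} \<in> \<CC>))"

definition corefines :: "'a set set \<Rightarrow> 'a set set \<Rightarrow> bool"  (infix "\<lless>" 50) where
  "\<B> \<lless> \<A> \<longleftrightarrow> (\<forall>A\<in>\<A>. \<exists>B\<in>\<B>. B \<subseteq> A)"

definition family_join :: "'a set set \<Rightarrow> 'a set set \<Rightarrow> 'a set set" where
  "family_join \<A> \<B> = {A \<union> B | A B. A \<in> \<A> \<and> B \<in> \<B>}"

text \<open>Intersecting with the carrier (below and in \<open>nearness_structure\<close>) makes the
  intersection of the empty family equal to the carrier; it changes nothing otherwise.\<close>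

definition resemblance_nearness :: "'a topology \<Rightarrow> 'a set set set \<Rightarrow> 'a set set set" where
  "resemblance_nearness X \<CC> =
     {\<A>. \<A> \<subseteq> Pow (topspace X) \<and>
          (topspace X \<inter> (\<Inter>A\<in>\<A>. X closure_of A) \<noteq> {} \<or>
           (\<exists>\<B>\<in>\<CC>. (\<forall>B\<in>\<B>. \<not> resemblance_bounded (topspace X) \<CC> B) \<and> \<B> \<lless> \<A>))}"

definition nearness_structure :: "'a set \<Rightarrow> 'a set set set \<Rightarrow> bool" where
  "nearness_structure S \<NN> \<longleftrightarrow>
     \<NN> \<subseteq> Pow (Pow S) \<and>
     (\<forall>\<A>. \<A> \<subseteq> Pow S \<and> S \<inter> \<Inter>\<A> \<noteq> {} \<longrightarrow> \<A> \<in> \<NN>) \<and>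
     (\<forall>\<A> \<B>. \<A> \<in> \<NN> \<and> \<B> \<subseteq> Pow S \<and> \<A> \<lless> \<B> \<longrightarrow> \<B> \<in> \<NN>) \<and>
     (\<forall>\<A>\<in>\<NN>. {} \<notin> \<A>) \<and>
     (\<forall>\<A> \<B>. \<A> \<subseteq> Pow S \<and> \<B> \<subseteq> Pow S \<and> \<A> \<notin> \<NN> \<and> \<B> \<notin> \<NN> \<longrightarrow> family_join \<A> \<B> \<notin> \<NN>)"

definition nearness_closed :: "'a set \<Rightarrow> 'a set set set \<Rightarrow> 'a set \<Rightarrow> bool" where
  "nearness_closed S \<NN> A \<longleftrightarrow> A \<subseteq> S \<and> A = {x \<in> S. {{x}, A} \<in> \<NN>}"

definition nearness_topology :: "'a set \<Rightarrow> 'a set set set \<Rightarrow> 'a topology" where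
  "nearness_topology S \<NN> = topology (\<lambda>U. U \<subseteq> S \<and> nearness_closed S \<NN> (S - U))"

text \<open>\<open>topology\<close> is meaningful only for predicates satisfying \<open>istopology\<close>; the following
  lemmas show that this is the case here for every nearness structure.\<close>

lemma nearness_structureD:
  assumes "nearness_structure S \<NN>"
  shows nearness_point: "\<A> \<subseteq> Pow S \<Longrightarrow> S \<inter> \<Inter>\<A> \<noteq> {} \<Longrightarrow> \<A> \<in> \<NN>"
    and nearness_mono: "\<A> \<in> \<NN> \<Longrightarrow> \<A> \<lless> \<B> \<Longrightarrow> \<B> \<subseteq> Pow S \<Longrightarrow> \<B> \<in> \<NN>"
    and nearness_empty: "\<A> \<in> \<NN> \<Longrightarrow> {} \<notin> \<A>"
    and nearness_join: "\<A> \<subseteq> Pow S \<Longrightarrow> \<B> \<subseteq> Pow S \<Longrightarrow> \<A> \<notin> \<NN> \<Longrightarrow> \<B> \<notin> \<NN> \<Longrightarrow> family_join \<A> \<B> \<notin> \<NN>"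
proof -
  note N = assms[unfolded nearness_structure_def]
  show "\<A> \<subseteq> Pow S \<Longrightarrow> S \<inter> \<Inter>\<A> \<noteq> {} \<Longrightarrow> \<A> \<in> \<NN>"
    by (rule N[THEN conjunct2, THEN conjunct1, rule_format]) (rule conjI)
  show "\<A> \<in> \<NN> \<Longrightarrow> \<A> \<lless> \<B> \<Longrightarrow> \<B> \<subseteq> Pow S \<Longrightarrow> \<B> \<in> \<NN>"
    by (rule N[THEN conjunct2, THEN conjunct2, THEN conjunct1, rule_format]) (intro conjI)
  show "\<A> \<in> \<NN> \<Longrightarrow> {} \<notin> \<A>"
    by (rule N[THEN conjunct2, THEN conjunct2, THEN conjunct2, THEN conjunct1, rule_format])
  show "\<A> \<subseteq> Pow S \<Longrightarrow> \<B> \<subseteq> Pow S \<Longrightarrow> \<A> \<notin> \<NN> \<Longrightarrow> \<B> \<notin> \<NN> \<Longrightarrow> family_join \<A> \<B> \<notin> \<NN>"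
    by (rule N[THEN conjunct2, THEN conjunct2, THEN conjunct2, THEN conjunct2, rule_format]) (intro conjI)
qed

lemma nearness_closed_iff:
  "nearness_closed S \<NN> A \<longleftrightarrow> A \<subseteq> S \<and> (\<forall>x\<in>S. {{x}, A} \<in> \<NN> \<longleftrightarrow> x \<in> A)"
  unfolding nearness_closed_def by blast

lemma nearness_closedI:
  assumes "nearness_structure S \<NN>" "A \<subseteq> S" "\<And>x. x \<in> S \<Longrightarrow> {{x}, A} \<in> \<NN> \<Longrightarrow> x \<in> A"
  shows "nearness_closed S \<NN> A"
proof -
  have "{{x}, A} \<in> \<NN>" if "x \<in> A" for x
    using that assms(2) by (intro nearness_point[OF assms(1)]) auto
  with assms(2,3) show ?thesis unfolding nearness_closed_iff by auto
qed

lemma nearness_closed_Un: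
  assumes N: "nearness_structure S \<NN>"
    and A: "nearness_closed S \<NN> A" and B: "nearness_closed S \<NN> B"
  shows "nearness_closed S \<NN> (A \<union> B)"
proof (rule nearness_closedI[OF N])
  show "A \<union> B \<subseteq> S" using A B by (auto simp: nearness_closed_iff)
  fix x assume x: "x \<in> S" and near: "{{x}, A \<union> B} \<in> \<NN>"
  show "x \<in> A \<union> B"
  proof (rule ccontr)
    assume "x \<notin> A \<union> B"
    then have "{{x}, A} \<notin> \<NN>" "{{x}, B} \<notin> \<NN>" using A B x by (auto simp: nearness_closed_iff)
    moreover have S: "{{x}, A} \<subseteq> Pow S" "{{x}, B} \<subseteq> Pow S"
      using A B x by (auto simp: nearness_closed_iff)
    ultimately have "family_join {{x}, A} {{x}, B} \<notin> \<NN>"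
      using nearness_join[OF N] by metis
    moreover have "{{x}, A \<union> B} \<lless> family_join {{x}, A} {{x}, B}"
      unfolding corefines_def family_join_def by auto
    moreover have "family_join {{x}, A} {{x}, B} \<subseteq> Pow S"
      using S by (auto simp: family_join_def)
    ultimately show False using nearness_mono[OF N near] by blast
  qed
qed

lemma nearness_closed_Inter:
  assumes N: "nearness_structure S \<NN>" and K: "\<And>A. A \<in> \<K> \<Longrightarrow> nearness_closed S \<NN> A"
  shows "nearness_closed S \<NN> (S \<inter> \<Inter>\<K>)"
proof (rule nearness_closedI[OF N])
  fix x assume x: "x \<in> S" and near: "{{x}, S \<inter> \<Inter>\<K>} \<in> \<NN>"
  have "x \<in> A" if "A \<in> \<K>" for A
  proof -
    have "{{x}, S \<inter> \<Inter>\<K>} \<lless> {{x}, A}" using that by (auto simp: corefines_def)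
    moreover have "{{x}, A} \<subseteq> Pow S" using K[OF that] x by (auto simp: nearness_closed_iff)
    ultimately have "{{x}, A} \<in> \<NN>" using nearness_mono[OF N near] by blast
    then show ?thesis using K[OF that] x by (auto simp: nearness_closed_iff)
  qed
  with x show "x \<in> S \<inter> \<Inter>\<K>" by blast
qed auto

lemma istopology_nearness:
  assumes N: "nearness_structure S \<NN>"
  shows "istopology (\<lambda>U. U \<subseteq> S \<and> nearness_closed S \<NN> (S - U))"
  unfolding istopology_def
proof (intro conjI allI impI)
  fix U V assume "U \<subseteq> S \<and> nearness_closed S \<NN> (S - U)" "V \<subseteq> S \<and> nearness_closed S \<NN> (S - V)"
  then show "nearness_closed S \<NN> (S - U \<inter> V)" "U \<inter> V \<subseteq> S"
    using nearness_closed_Un[OF N, of "S - U" "S - V"] by (auto simp: Diff_Int)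
next
  fix \<K> assume K: "\<forall>K\<in>\<K>. K \<subseteq> S \<and> nearness_closed S \<NN> (S - K)"
  have "nearness_closed S \<NN> (S \<inter> \<Inter>((\<lambda>K. S - K) ` \<K>))"
    using K by (intro nearness_closed_Inter[OF N]) auto
  moreover have "S \<inter> \<Inter>((\<lambda>K. S - K) ` \<K>) = S - \<Union>\<K>" by auto
  ultimately show "nearness_closed S \<NN> (S - \<Union>\<K>)" by simp
  show "\<Union>\<K> \<subseteq> S" using K by blast
qed

lemma openin_nearness_topology:
  assumes "nearness_structure S \<NN>"
  shows "openin (nearness_topology S \<NN>) U \<longleftrightarrow> U \<subseteq> S \<and> nearness_closed S \<NN> (S - U)"
  by (simp add: nearness_topology_def istopology_nearness[OF assms])

lemma topspace_nearness_topology: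
  assumes N: "nearness_structure S \<NN>"
  shows "topspace (nearness_topology S \<NN>) = S"
proof -
  have "{{x}, {}} \<notin> \<NN>" for x using nearness_empty[OF N] by blast
  then have "openin (nearness_topology S \<NN>) S"
    by (auto simp: openin_nearness_topology[OF N] nearness_closed_iff)
  then show ?thesis
    using openin_nearness_topology[OF N] openin_subset openin_topspace by (metis subset_antisym)
qed

lemma closedin_nearness_topology:
  assumes N: "nearness_structure S \<NN>"
  shows "closedin (nearness_topology S \<NN>) A \<longleftrightarrow> nearness_closed S \<NN> A"
proof (cases "A \<subseteq> S")
  case True
  then show ?thesis
    by (auto simp: closedin_def topspace_nearness_topology[OF N] openin_nearness_topology[OF N]
        double_diff)
qed (auto simp: closedin_def topspace_nearness_topology[OF N] nearness_closed_iff)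

text \<open>A symmetric (\<open>R\<^sub>0\<close>) space; every \<open>T\<^sub>1\<close> space is one. As is standard for nearness spaces,
  only symmetric topologies can be induced by a nearness: for the Sierpinski space the family
  \<open>resemblance_nearness\<close> is a nearness structure whose topology is indiscrete.\<close>

definition R0_space :: "'a topology \<Rightarrow> bool" where
  "R0_space X \<longleftrightarrow>
     (\<forall>x\<in>topspace X. \<forall>y\<in>topspace X. x \<in> X closure_of {y} \<longrightarrow> y \<in> X closure_of {x})"

end

theory Submission
  imports Defs
begin

text \<open>The only delicate axiom is the one on joins. Let \<open>\<D>\<close> consist of unbounded sets that are
  pairwise \<open>E\<close>-close and refine \<open>\<A> \<or> \<B>\<close>, and fix \<open>D \<in> \<D>\<close>. For all \<open>A \<in> \<A>\<close>, \<open>B \<in> \<B>\<close> we get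
  \<open>D \<subseteq> E(A) \<union> E(B)\<close>, so by distributivity \<open>D\<close> is the union of \<open>D \<inter> \<Inter>\<^sub>A E(A)\<close> and
  \<open>D \<inter> \<Inter>\<^sub>B E(B)\<close>. By connectedness one of these two sets is unbounded, and an unbounded set
  inside every \<open>E(A)\<close> makes \<open>\<A>\<close> near. For the topology, singletons are bounded, so \<open>{x}\<close> and
  \<open>A\<close> are near iff their closures meet, which in a symmetric space means \<open>x \<in> cl A\<close>.\<close>

lemma coarse_structureD:
  assumes "coarse_structure S \<E>"
  shows coarse_subset_carrier: "E \<in> \<E> \<Longrightarrow> E \<subseteq> S \<times> S"
    and coarse_Id: "Id_on S \<in> \<E>"
    and coarse_Un: "E \<in> \<E> \<Longrightarrow> F \<in> \<E> \<Longrightarrow> E \<union> F \<in> \<E>"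
    and coarse_converse: "E \<in> \<E> \<Longrightarrow> E\<inverse> \<in> \<E>"
    and coarse_comp: "E \<in> \<E> \<Longrightarrow> F \<in> \<E> \<Longrightarrow> F O E \<in> \<E>"
  using assms unfolding coarse_structure_def by (meson PowD subsetD)+

text \<open>Membership of \<open>{B, {x}}\<close> in the resemblance asks for four inclusions, but
  controlling \<open>B\<close> by one ball around \<open>x\<close> suffices: symmetrising the
  entourage supplies the others. For empty \<open>B\<close>, the diagonal and any point of the
  carrier serve.\<close>

lemma bounded_coarse_iff:
  assumes C: "coarse_structure S \<E>" and ne: "S \<noteq> {}"
  shows "resemblance_bounded S (coarse_resemblance S \<E>) B \<longleftrightarrow>
    B \<subseteq> S \<and> (\<exists>E\<in>\<E>. \<exists>x\<in>S. B \<subseteq> E `` {x})"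
proof
  assume B: "resemblance_bounded S (coarse_resemblance S \<E>) B"
  show "B \<subseteq> S \<and> (\<exists>E\<in>\<E>. \<exists>x\<in>S. B \<subseteq> E `` {x})"
  proof (cases "B = {}")
    case True
    then show ?thesis using coarse_Id[OF C] ne by auto
  next
    case False
    with B obtain x where "B \<subseteq> S" "x \<in> S" "{B, {x}} \<in> coarse_resemblance S \<E>"
      unfolding resemblance_bounded_def by auto
    then show ?thesis unfolding coarse_resemblance_def by auto
  qed
next
  assume "B \<subseteq> S \<and> (\<exists>E\<in>\<E>. \<exists>x\<in>S. B \<subseteq> E `` {x})"
  then obtain E x where B: "B \<subseteq> S" and E: "E \<in> \<E>" and x: "x \<in> S" and sub: "B \<subseteq> E `` {x}"
    by blast
  have "{B, {x}} \<in> coarse_resemblance S \<E>" if "B \<noteq> {}"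
  proof -
    \<comment> \<open>\<open>E\<close> covers \<open>B\<close> from \<open>x\<close>, its converse
      covers \<open>x\<close> from the nonempty \<open>B\<close>, and the diagonal covers each of
      the two sets from itself.\<close>
    let ?F = "E \<union> E\<inverse> \<union> Id_on S \<union> E O E\<inverse>"
    have "?F \<in> \<E>"
      using E by (intro coarse_Un[OF C] coarse_converse[OF C] coarse_comp[OF C] coarse_Id[OF C])
    moreover have "\<forall>A\<in>{B, {x}}. \<forall>A'\<in>{B, {x}}. A \<subseteq> ?F `` A'"
      using B x sub that by blast
    ultimately show ?thesis using B x unfolding coarse_resemblance_def by blast
  qed
  then show "resemblance_bounded S (coarse_resemblance S \<E>) B"
    using B x unfolding resemblance_bounded_def by blast
qed

lemma bounded_coarse_mono:
  assumes "coarse_structure S \<E>" "S \<noteq> {}"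
    and "resemblance_bounded S (coarse_resemblance S \<E>) B" "A \<subseteq> B"
  shows "resemblance_bounded S (coarse_resemblance S \<E>) A"
  using assms(3,4) unfolding bounded_coarse_iff[OF assms(1,2)] by blast

text \<open>Used contrapositively: a set whose image under a member of \<open>\<E>\<close> contains
  an unbounded set is itself unbounded.\<close>

lemma bounded_coarse_Image:
  assumes C: "coarse_structure S \<E>" and ne: "S \<noteq> {}" and F: "F \<in> \<E>"
    and B: "resemblance_bounded S (coarse_resemblance S \<E>) B"
  shows "resemblance_bounded S (coarse_resemblance S \<E>) (F `` B)"
proof -
  obtain E x where E: "E \<in> \<E>" and x: "x \<in> S" and sub: "B \<subseteq> E `` {x}"
    using B unfolding bounded_coarse_iff[OF C ne] by blast
  have "F `` B \<subseteq> (E O F) `` {x}" using sub by blast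
  then show ?thesis
    using x coarse_comp[OF C F E] coarse_subset_carrier[OF C F]
    unfolding bounded_coarse_iff[OF C ne] by blast
qed

text \<open>Connectedness enters here: an entourage \<open>G\<close> through \<open>(x, y)\<close>
  puts the ball around \<open>y\<close> inside a ball around \<open>x\<close>, giving both sets a
  common centre.\<close>

lemma bounded_coarse_Un:
  assumes C: "coarse_structure S \<E>" and ne: "S \<noteq> {}" and con: "coarse_connected S \<E>"
    and A: "resemblance_bounded S (coarse_resemblance S \<E>) A"
    and B: "resemblance_bounded S (coarse_resemblance S \<E>) B"
  shows "resemblance_bounded S (coarse_resemblance S \<E>) (A \<union> B)"
proof -
  obtain E x where E: "E \<in> \<E>" "x \<in> S" "A \<subseteq> S" "A \<subseteq> E `` {x}"
    using A unfolding bounded_coarse_iff[OF C ne] by blast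
  obtain F y where F: "F \<in> \<E>" "y \<in> S" "B \<subseteq> S" "B \<subseteq> F `` {y}"
    using B unfolding bounded_coarse_iff[OF C ne] by blast
  obtain G where G: "G \<in> \<E>" "(x, y) \<in> G"
    using con E(2) F(2) unfolding coarse_connected_def by blast
  have "E \<union> G O F \<in> \<E>" using E(1) F(1) G(1) by (intro coarse_Un[OF C] coarse_comp[OF C])
  moreover have "A \<union> B \<subseteq> (E \<union> G O F) `` {x}" using E(4) F(4) G(2) by blast
  ultimately show ?thesis using E(2,3) F(3) unfolding bounded_coarse_iff[OF C ne] by blast
qed

lemma bounded_coarse_singleton:
  assumes C: "coarse_structure S \<E>" and x: "x \<in> S"
  shows "resemblance_bounded S (coarse_resemblance S \<E>) {x}"
proof -
  have "{x} \<subseteq> Id_on S `` {x}" using x by blast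
  moreover have "S \<noteq> {}" using x by blast
  ultimately show ?thesis using x coarse_Id[OF C] bounded_coarse_iff[OF C, of "{x}"] by blast
qed

text \<open>\<open>T\<close> is covered from each member of \<open>\<A>\<close> but need not lie
  inside it. The refining family consists of the parts of these members that \<open>E\<close>
  relates to \<open>T\<close>; they are mutually close through \<open>T\<close> and inherit its
  unboundedness.\<close>

lemma unbounded_refinement:
  assumes C: "coarse_structure S \<E>" and ne: "S \<noteq> {}" and E: "E \<in> \<E>"
    and T: "\<And>A. A \<in> \<A> \<Longrightarrow> T \<subseteq> E `` A"
    and unb: "\<not> resemblance_bounded S (coarse_resemblance S \<E>) T"
  shows "\<exists>\<B>\<in>coarse_resemblance S \<E>.
    (\<forall>B\<in>\<B>. \<not> resemblance_bounded S (coarse_resemblance S \<E>) B) \<and> \<B> \<lless> \<A>"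
proof (intro bexI conjI)
  \<comment> \<open>Trimming loses no covering of \<open>T\<close>: a point of \<open>A\<close> that
    \<open>E\<close> relates to a point of \<open>T\<close> is kept.\<close>
  define \<B> where "\<B> = (\<lambda>A. A \<inter> E\<inverse> `` T) ` \<A>"
  have close: "T \<subseteq> E `` B" "B \<subseteq> E\<inverse> `` T" if "B \<in> \<B>" for B
    using that T unfolding \<B>_def by blast+
  show "\<forall>B\<in>\<B>. \<not> resemblance_bounded S (coarse_resemblance S \<E>) B"
    using close(1) unb bounded_coarse_Image[OF C ne E] bounded_coarse_mono[OF C ne] by blast
  show "\<B> \<lless> \<A>" unfolding \<B>_def corefines_def by blast
  \<comment> \<open>A point of \<open>B\<close> is \<open>E\<close>-related to some \<open>t\<close>
    in \<open>T\<close>, and \<open>t\<close> is in turn reached by \<open>E\<close> from a point of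
    \<open>B'\<close>.\<close>
  have "\<forall>B\<in>\<B>. \<forall>B'\<in>\<B>. B \<subseteq> (E O E\<inverse>) `` B'"
    using close by blast
  moreover have "\<B> \<subseteq> Pow S"
    using coarse_subset_carrier[OF C E] unfolding \<B>_def by blast
  moreover have "E O E\<inverse> \<in> \<E>" using E by (intro coarse_comp[OF C] coarse_converse[OF C])
  ultimately show "\<B> \<in> coarse_resemblance S \<E>" unfolding coarse_resemblance_def by blast
qed

lemma unbounded_refinement_join:
  assumes C: "coarse_structure S \<E>" and ne: "S \<noteq> {}" and con: "coarse_connected S \<E>"
    and \<D>: "\<D> \<in> coarse_resemblance S \<E>"
    and unb: "\<forall>D\<in>\<D>. \<not> resemblance_bounded S (coarse_resemblance S \<E>) D"
    and ref: "\<D> \<lless> family_join \<A> \<B>" and nonempty: "\<A> \<noteq> {}" "\<B> \<noteq> {}"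
  obtains \<D>' where "\<D>' \<in> coarse_resemblance S \<E>"
    "\<forall>D\<in>\<D>'. \<not> resemblance_bounded S (coarse_resemblance S \<E>) D" "\<D>' \<lless> \<A> \<or> \<D>' \<lless> \<B>"
proof -
  have ref': "\<exists>D\<in>\<D>. D \<subseteq> A \<union> B" if "A \<in> \<A>" "B \<in> \<B>" for A B
    using ref that unfolding corefines_def family_join_def by blast
  \<comment> \<open>One pair of members is enough to force \<open>\<D>\<close> to be nonempty; the
    set \<open>D\<close> obtained from it stays fixed from here on.\<close>
  obtain A\<^sub>0 B\<^sub>0 where "A\<^sub>0 \<in> \<A>" "B\<^sub>0 \<in> \<B>" using nonempty by blast
  from ref'[OF this] obtain D where D: "D \<in> \<D>" by blast
  obtain E where E: "E \<in> \<E>" "\<forall>D\<in>\<D>. \<forall>D'\<in>\<D>. D \<subseteq> E `` D'"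
    using \<D> unfolding coarse_resemblance_def mem_Collect_eq by (elim conjE bexE)
  \<comment> \<open>The set of \<open>\<D>\<close> inside \<open>A \<union> B\<close> varies with
    the pair; closeness under the single entourage \<open>E\<close> transfers the covering to the
    fixed \<open>D\<close>.\<close>
  have cover: "D \<subseteq> E `` A \<union> E `` B" if "A \<in> \<A>" "B \<in> \<B>" for A B
    using ref'[OF that] E(2) D by blast
  define T U where "T = D \<inter> (\<Inter>A\<in>\<A>. E `` A)" and "U = D \<inter> (\<Inter>B\<in>\<B>. E `` B)"
  \<comment> \<open>A point of \<open>D\<close> outside both \<open>T\<close> and \<open>U\<close>
    would miss the \<open>E\<close>-image of some \<open>A\<close> and of some \<open>B\<close>,
    against \<open>cover\<close> for that pair.\<close>
  have "D = T \<union> U" using cover unfolding T_def U_def by blast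
  then have "\<not> resemblance_bounded S (coarse_resemblance S \<E>) T \<or>
      \<not> resemblance_bounded S (coarse_resemblance S \<E>) U"
    using unb D bounded_coarse_Un[OF C ne con] by metis
  moreover have "T \<subseteq> E `` A" if "A \<in> \<A>" for A using that unfolding T_def by blast
  moreover have "U \<subseteq> E `` B" if "B \<in> \<B>" for B using that unfolding U_def by blast
  ultimately show thesis
    using unbounded_refinement[OF C ne E(1), of \<A> T] unbounded_refinement[OF C ne E(1), of \<B> U] that
    by blast
qed

lemma resemblance_nearness_pointI:
  assumes "\<A> \<subseteq> Pow (topspace X)" "x \<in> topspace X" "\<And>A. A \<in> \<A> \<Longrightarrow> x \<in> X closure_of A"
  shows "\<A> \<in> resemblance_nearness X \<CC>"
proof -
  have "x \<in> topspace X \<inter> (\<Inter>A\<in>\<A>. X closure_of A)" using assms(2,3) by simp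
  then show ?thesis using assms(1) unfolding resemblance_nearness_def mem_Collect_eq by (metis empty_iff)
qed

lemma resemblance_nearness_refineI:
  assumes "\<A> \<subseteq> Pow (topspace X)" "\<D> \<in> \<CC>"
    "\<forall>D\<in>\<D>. \<not> resemblance_bounded (topspace X) \<CC> D" "\<D> \<lless> \<A>"
  shows "\<A> \<in> resemblance_nearness X \<CC>"
  using assms unfolding resemblance_nearness_def mem_Collect_eq by (metis (lifting))

lemma resemblance_nearness_cases:
  assumes "\<A> \<in> resemblance_nearness X \<CC>"
  obtains (point) x where "x \<in> topspace X" "\<And>A. A \<in> \<A> \<Longrightarrow> x \<in> X closure_of A"
  | (refine) \<D> where "\<D> \<in> \<CC>" "\<forall>D\<in>\<D>. \<not> resemblance_bounded (topspace X) \<CC> D" "\<D> \<lless> \<A>"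
proof -
  have "topspace X \<inter> (\<Inter>A\<in>\<A>. X closure_of A) \<noteq> {} \<or>
      (\<exists>\<D>\<in>\<CC>. (\<forall>D\<in>\<D>. \<not> resemblance_bounded (topspace X) \<CC> D) \<and> \<D> \<lless> \<A>)"
    using assms unfolding resemblance_nearness_def mem_Collect_eq by (rule conjunct2)
  then show thesis
  proof
    assume "topspace X \<inter> (\<Inter>A\<in>\<A>. X closure_of A) \<noteq> {}"
    then obtain x where "x \<in> topspace X \<inter> (\<Inter>A\<in>\<A>. X closure_of A)" by (metis ex_in_conv)
    then show thesis by (intro point[of x]) simp_all
  next
    assume "\<exists>\<D>\<in>\<CC>. (\<forall>D\<in>\<D>. \<not> resemblance_bounded (topspace X) \<CC> D) \<and> \<D> \<lless> \<A>"
    then show thesis by (elim bexE conjE) (rule refine)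
  qed
qed

lemma nearness_structure_resemblance:
  assumes ne: "topspace X \<noteq> {}" and C: "coarse_structure (topspace X) \<E>"
    and con: "coarse_connected (topspace X) \<E>"
  shows "nearness_structure (topspace X)
    (resemblance_nearness X (coarse_resemblance (topspace X) \<E>))"
proof -
  let ?S = "topspace X" and ?C = "coarse_resemblance (topspace X) \<E>"
  let ?N = "resemblance_nearness X ?C"
  show ?thesis
    unfolding nearness_structure_def
  proof (intro conjI allI ballI impI)
    show "?N \<subseteq> Pow (Pow ?S)" unfolding resemblance_nearness_def by (intro subsetI) simp
  next
    fix \<A> assume A: "\<A> \<subseteq> Pow ?S \<and> ?S \<inter> \<Inter>\<A> \<noteq> {}"
    then obtain x where x: "x \<in> ?S" "\<And>A. A \<in> \<A> \<Longrightarrow> x \<in> A" by auto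
    have "x \<in> X closure_of A" if "A \<in> \<A>" for A
      using closure_of_subset[of A X] A that x(2)[OF that] by auto
    then show "\<A> \<in> ?N" using A x(1) by (intro resemblance_nearness_pointI[of _ _ x]) simp_all
  next
    fix \<A> \<B> assume H: "\<A> \<in> ?N \<and> \<B> \<subseteq> Pow ?S \<and> \<A> \<lless> \<B>"
    have ref: "\<exists>A\<in>\<A>. A \<subseteq> B" if "B \<in> \<B>" for B
      using H that unfolding corefines_def by simp
    from H have "\<A> \<in> ?N" by (rule conjunct1)
    then show "\<B> \<in> ?N"
    proof (cases rule: resemblance_nearness_cases)
      case (point x)
      have "x \<in> X closure_of B" if "B \<in> \<B>" for B
        using ref[OF that] point(2) closure_of_mono by (metis subsetD)
      then show ?thesis using H point(1) by (intro resemblance_nearness_pointI[of _ _ x]) simp_all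
    next
      case (refine \<D>)
      have "\<D> \<lless> \<B>"
        using refine(3) ref unfolding corefines_def by (meson order_trans)
      then show ?thesis using H refine(1,2) by (intro resemblance_nearness_refineI[of _ _ \<D>]) simp_all
    qed
  next
    fix \<A> assume "\<A> \<in> ?N"
    then show "{} \<notin> \<A>"
    proof (cases rule: resemblance_nearness_cases)
      case (point x)
      then show ?thesis by (metis closure_of_empty empty_iff)
    next
      case (refine \<D>)
      have "resemblance_bounded ?S ?C {}" unfolding resemblance_bounded_def by simp
      then show ?thesis using refine(2,3) unfolding corefines_def by (metis subset_empty)
    qed
  next
    fix \<A> \<B> assume H: "\<A> \<subseteq> Pow ?S \<and> \<B> \<subseteq> Pow ?S \<and> \<A> \<notin> ?N \<and> \<B> \<notin> ?N"
    then have sub: "\<A> \<subseteq> Pow ?S" "\<B> \<subseteq> Pow ?S" and far: "\<A> \<notin> ?N" "\<B> \<notin> ?N" by simp_all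
    \<comment> \<open>The empty family is near because its intersection is the nonempty carrier, so
      families that are not near have members.\<close>
    have nonempty: "\<A> \<noteq> {}" "\<B> \<noteq> {}"
      using ne far resemblance_nearness_pointI[of "{}"] by (metis empty_iff empty_subsetI ex_in_conv)+
    show "family_join \<A> \<B> \<notin> ?N"
    proof
      assume "family_join \<A> \<B> \<in> ?N"
      then show False
      proof (cases rule: resemblance_nearness_cases)
        case (point x)
        have "x \<in> X closure_of A \<or> x \<in> X closure_of B" if "A \<in> \<A>" "B \<in> \<B>" for A B
        proof -
          have "A \<union> B \<in> family_join \<A> \<B>" using that unfolding family_join_def by blast
          then have "x \<in> X closure_of (A \<union> B)" by (rule point(2))
          then show ?thesis by (simp add: closure_of_Un)
        qed
        \<comment> \<open>Otherwise \<open>x\<close> would miss the closures of some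
          \<open>A\<close> and some \<open>B\<close>, a pair excluded by the preceding fact.\<close>
        then have "(\<forall>A\<in>\<A>. x \<in> X closure_of A) \<or> (\<forall>B\<in>\<B>. x \<in> X closure_of B)" by metis
        then show False using far resemblance_nearness_pointI[OF _ point(1)] sub by metis
      next
        case (refine \<D>)
        obtain \<D>' where "\<D>' \<in> ?C" "\<forall>D\<in>\<D>'. \<not> resemblance_bounded ?S ?C D" "\<D>' \<lless> \<A> \<or> \<D>' \<lless> \<B>"
          using unbounded_refinement_join[OF C ne con refine nonempty] .
        then show False using far resemblance_nearness_refineI sub by metis
      qed
    qed
  qed
qed

text \<open>Nearness of a point to a set recovers the closure operator of \<open>X\<close>, and the
  closed sets of the two topologies are compared through it.\<close>

lemma resemblance_nearness_point_iff:
  assumes C: "coarse_structure (topspace X) \<E>" and R0: "R0_space X"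
    and x: "x \<in> topspace X" and A: "A \<subseteq> topspace X"
  shows "{{x}, A} \<in> resemblance_nearness X (coarse_resemblance (topspace X) \<E>) \<longleftrightarrow>
    x \<in> X closure_of A"
proof
  let ?S = "topspace X" and ?C = "coarse_resemblance (topspace X) \<E>"
  assume "{{x}, A} \<in> resemblance_nearness X ?C"
  then show "x \<in> X closure_of A"
  proof (cases rule: resemblance_nearness_cases)
    case (point y)
    then have y: "y \<in> X closure_of {x}" "y \<in> X closure_of A" by simp_all
    \<comment> \<open>Symmetry reverses the relation between \<open>x\<close> and the common closure
      point \<open>y\<close>, so \<open>x\<close> lies in the closure of \<open>y\<close> and hence
      in that of \<open>A\<close>.\<close>
    have "x \<in> X closure_of {y}" using R0 x point(1) y(1) unfolding R0_space_def by simp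
    moreover have "X closure_of {y} \<subseteq> X closure_of A"
      using y(2) by (intro closure_of_minimal) auto
    ultimately show ?thesis by (rule rev_subsetD)
  next
    case (refine \<D>)
    \<comment> \<open>This case is impossible: a member of \<open>\<D>\<close> inside
      \<open>{x}\<close> is \<open>{}\<close> or \<open>{x}\<close>, and both are bounded.\<close>
    have "resemblance_bounded ?S ?C {}" unfolding resemblance_bounded_def by simp
    then show ?thesis
      using refine(2,3) bounded_coarse_singleton[OF C x] unfolding corefines_def
      by (metis insertI1 subset_singletonD)
  qed
next
  assume "x \<in> X closure_of A"
  moreover have "x \<in> X closure_of {x}" using closure_of_subset[of "{x}" X] x by auto
  ultimately show "{{x}, A} \<in> resemblance_nearness X (coarse_resemblance (topspace X) \<E>)"
    using x A by (intro resemblance_nearness_pointI[of _ _ x]) auto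
qed

theorem theorem4p8:
  fixes X :: "'a topology" and \<E> :: "('a \<times> 'a) set set"
  assumes "topspace X \<noteq> {}"
    and "coarse_structure (topspace X) \<E>"
    and "coarse_connected (topspace X) \<E>"
  defines "\<CC> \<equiv> coarse_resemblance (topspace X) \<E>"
  defines "\<NN> \<equiv> resemblance_nearness X \<CC>"
  shows "nearness_structure (topspace X) \<NN> \<and>
         (R0_space X \<longrightarrow> nearness_topology (topspace X) \<NN> = X)"
proof (intro conjI impI)
  show N: "nearness_structure (topspace X) \<NN>"
    unfolding \<NN>_def \<CC>_def by (rule nearness_structure_resemblance[OF assms(1-3)])
  assume R0: "R0_space X"
  have "closedin (nearness_topology (topspace X) \<NN>) A \<longleftrightarrow> closedin X A" for A
  proof (cases "A \<subseteq> topspace X")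
    case True
    have "closedin (nearness_topology (topspace X) \<NN>) A \<longleftrightarrow>
        (\<forall>x\<in>topspace X. x \<in> X closure_of A \<longleftrightarrow> x \<in> A)"
      using True resemblance_nearness_point_iff[OF assms(2) R0 _ True]
      unfolding closedin_nearness_topology[OF N] nearness_closed_iff
      by (simp add: \<NN>_def \<CC>_def)
    also have "\<dots> \<longleftrightarrow> X closure_of A = A"
      using True closure_of_subset_topspace[of X A] by blast
    also have "\<dots> \<longleftrightarrow> closedin X A" by (rule closure_of_eq)
    finally show ?thesis .
  next
    case False
    then show ?thesis
      by (metis closedin_subset topspace_nearness_topology[OF N])
  qed
  then show "nearness_topology (topspace X) \<NN> = X"
    unfolding topology_eq openin_closedin_eq topspace_nearness_topology[OF N] by blast
qed

end
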